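(* There exists an absolute constant $c>0$ such that for every sufficiently large positive integer $N$ and every real $Q$ with $cN^{2/3}\le Q\le N$, one has $$V(N,Q;d_1)\gg Q^2,$$ where the implied constant is absolute and $d_1$ is the constant function $d_1(n)=1$ for all $n\in\mathbb{N}$.
   Context: For an arithmetic function $f:\mathbb{N}\to\mathbb{C}$, a positive integer $N$ and a real number $1<Q\le N$, the variance of $f$ in arithmetic progressions is $$V(N,Q;f):=\sum_{q\le Q}\ \sum_{h\mid q}\ \sum_{\substack{a \bmod q\\ (a,q)=h}}\Bigg|\sum_{\substack{n\le N\\ n\equiv a \bmod q}}f(n)-\frac{1}{\varphi(q/h)}\sum_{\substack{n\le N\\ (n,q)=h}}f(n)\Bigg|^2,$$ where $\varphi$ is Euler's totient function and $(\cdot,\cdot)$ is the greatest common divisor. $A\gg B$ means $A\ge \kappa B$ for some constant $\kappa>0$. *)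

theory Defs
  imports Complex_Main "HOL-Number_Theory.Number_Theory"
begin

text \<open>
  The variance of an arithmetic function in arithmetic progressions. The arguments of
  the arithmetic function are the positive integers, so the value \<open>f 0\<close> plays no role;
  the residue classes modulo \<open>q\<close> are represented by \<open>1, \<dots>, q\<close>.
\<close>

definition ap_variance :: "nat \<Rightarrow> real \<Rightarrow> (nat \<Rightarrow> complex) \<Rightarrow> real" where
  "ap_variance N Q f =
     (\<Sum>q\<in>{1..nat \<lfloor>Q\<rfloor>}. \<Sum>h | h dvd q. \<Sum>a | a \<in> {1..q} \<and> gcd a q = h.
        (cmod ((\<Sum>n | n \<in> {1..N} \<and> [n = a] (mod q). f n)
               - 1 / of_nat (totient (q div h)) * (\<Sum>n | n \<in> {1..N} \<and> gcd n q = h. f n)))\<^sup>2)"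

definition d1 :: "nat \<Rightarrow> complex" where
  "d1 n = 1"

end

(*
  Modulo q the involution a -> q - a preserves gcd a q. Write r = N mod q. If
  1 <= a <= min r (q - 1 - r), then the class of a contains exactly one more n <= N than
  the class of q - a, while both are compared with the same mean value; so the two terms
  contribute at least 1/2, whatever that mean value is. The modulus q thus
  contributes at least half of min r (q - 1 - r), which up to O(1) is half of q times the
  distance of N/q to the nearest integer. For t = K^2 div (8N), where K is the integer part
  of Q, and K/2 < q <= K - t, the difference N/q - N/(q+t) lies in [1/16, 1/2], so N/q and
  N/(q+t) cannot both be close to integers. Summing over q gives order K^2.
*)
theory Submission
  imports Defs "HOL-Real_Asymp.Real_Asymp"
begin

definition int_dist :: "real \<Rightarrow> real" where
  "int_dist x = \<bar>x - of_int (round x)\<bar>"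

lemma int_dist_nonneg: "0 \<le> int_dist x"
  by (simp add: int_dist_def)

lemma int_dist_le: "int_dist x \<le> \<bar>x - of_int k\<bar>"
  using round_diff_minimal[of x k] by (simp add: int_dist_def)

text \<open>The integer \<open>round x - round y\<close> is at distance at least \<delta> from
  \<open>x - y\<close>, because \<open>x - y\<close> lies between 0 and 1 at distance at least
  \<delta> from both ends. The triangle inequality splits this distance between \<open>x\<close> and
  \<open>y\<close>.\<close>

lemma int_dist_add_ge:
  assumes "\<delta> \<le> x - y" "x - y \<le> 1 - \<delta>"
  shows "\<delta> \<le> int_dist x + int_dist y"
proof -
  define k where "k = round x - round y"
  have "k \<le> 0 \<or> 1 \<le> k" by linarith
  then have "of_int k \<le> (0::real) \<or> (1::real) \<le> of_int k" by linarith
  then have "\<delta> \<le> \<bar>(x - y) - of_int k\<bar>" using assms by linarith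
  also have "\<dots> \<le> int_dist x + int_dist y"
    by (simp add: int_dist_def k_def)
  finally show ?thesis .
qed

text \<open>The representative \<open>a\<close> in 1..q is the least positive member of its class,
  so the class is a + k * q with k \<ge> 0. The last index k = N div q fits below \<open>N\<close>
  exactly when a \<le> N mod q.\<close>

lemma card_residue_class:
  fixes N a q :: nat
  assumes "1 \<le> a" "a \<le> q"
  shows "card {n. n \<in> {1..N} \<and> [n = a] (mod q)} = N div q + (if a \<le> N mod q then 1 else 0)"
proof -
  have q: "q > 0" using assms by simp
  have "{n. n \<in> {1..N} \<and> [n = a] (mod q)} = (\<lambda>k. a + k * q) ` {k. a + k * q \<le> N}"
  proof (intro equalityI subsetI)
    fix n assume n: "n \<in> {n. n \<in> {1..N} \<and> [n = a] (mod q)}"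
    \<comment> \<open>Otherwise \<open>q\<close> would divide a - n, which lies strictly between 0
      and \<open>q\<close>.\<close>
    have "a \<le> n"
    proof (rule ccontr)
      assume "\<not> a \<le> n"
      moreover have "q dvd a - n"
        using n \<open>\<not> a \<le> n\<close> by (simp add: cong_altdef_nat cong_sym_eq)
      ultimately have "q \<le> a - n" by (simp add: dvd_imp_le)
      moreover have "1 \<le> n" using n by simp
      ultimately show False using assms \<open>\<not> a \<le> n\<close> by linarith
    qed
    then have "q dvd n - a" using n by (simp add: cong_altdef_nat)
    then obtain k where "n - a = q * k" by (rule dvdE)
    then have "n = a + k * q" using \<open>a \<le> n\<close> by (simp add: mult.commute)
    then show "n \<in> (\<lambda>k. a + k * q) ` {k. a + k * q \<le> N}" using n by auto
  qed (use assms in \<open>auto simp: unique_euclidean_semiring_class.cong_def\<close>)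
  moreover have "inj_on (\<lambda>k. a + k * q) A" for A
    using q by (auto simp: inj_on_def)
  moreover have "{k. a + k * q \<le> N} = {..<N div q + (if a \<le> N mod q then 1 else 0)}"
  proof (cases "a \<le> N mod q")
    case True
    have iff: "a + k * q \<le> N \<longleftrightarrow> k \<le> N div q" for k
    proof
      assume "a + k * q \<le> N"
      then show "k \<le> N div q" using q by (simp add: less_eq_div_iff_mult_less_eq)
    next
      assume "k \<le> N div q"
      then have "k * q \<le> N div q * q" by simp
      then show "a + k * q \<le> N" using True div_mult_mod_eq[of N q] by linarith
    qed
    show ?thesis unfolding iff using True by auto
  next
    case False
    have iff: "a + k * q \<le> N \<longleftrightarrow> k < N div q" for k
    proof
      assume *: "a + k * q \<le> N"
      show "k < N div q"
      proof (rule ccontr)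
        assume "\<not> k < N div q"
        then have "N div q * q \<le> k * q" by simp
        then show False using False * div_mult_mod_eq[of N q] by linarith
      qed
    next
      assume "k < N div q"
      then have "Suc k * q \<le> N div q * q" by (intro mult_le_mono1) simp
      then have "q + k * q \<le> N div q * q" by simp
      then show "a + k * q \<le> N" using assms div_mult_mod_eq[of N q] by linarith
    qed
    show ?thesis unfolding iff using False by auto
  qed
  ultimately show ?thesis by (simp add: card_image)
qed

lemma gcd_diff_self_nat:
  fixes a q :: nat
  assumes "a \<le> q"
  shows "gcd (q - a) q = gcd a q"
  using assms by (metis gcd.commute gcd_diff1_nat diff_diff_cancel diff_le_self)

text \<open>Triangle inequality through \<mu>, then (x + y)^2 \<le> 2 (x^2 + y^2). It makes the
  bound for a pair of classes independent of the mean value.\<close>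

lemma sum_squares_ge_half_diff_square:
  fixes u v \<mu> :: complex
  shows "(cmod (u - v))\<^sup>2 / 2 \<le> (cmod (u - \<mu>))\<^sup>2 + (cmod (v - \<mu>))\<^sup>2"
proof -
  define x y where "x = cmod (u - \<mu>)" and "y = cmod (v - \<mu>)"
  have "cmod (u - v) \<le> x + y"
    using norm_triangle_ineq4[of "u - \<mu>" "v - \<mu>"] by (simp add: x_def y_def)
  then have "(cmod (u - v))\<^sup>2 \<le> (x + y)\<^sup>2" by (simp add: power_mono)
  moreover have "0 \<le> (x - y)\<^sup>2" by simp
  ultimately show ?thesis
    unfolding x_def[symmetric] y_def[symmetric] by (simp add: power2_eq_square algebra_simps)
qed

text \<open>The centre \<mu> is arbitrary apart from depending on \<open>a\<close> only through
  \<open>gcd a q\<close>; hence \<open>a\<close> and \<open>q - a\<close> share it.\<close>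

lemma residue_class_variance_ge:
  fixes N q :: nat and \<mu> :: "nat \<Rightarrow> complex"
  assumes "q \<ge> 1"
  shows "(real q * int_dist (real N / real q) - 1) / 2 \<le>
    (\<Sum>h | h dvd q. \<Sum>a | a \<in> {1..q} \<and> gcd a q = h.
      (cmod ((\<Sum>n | n \<in> {1..N} \<and> [n = a] (mod q). d1 n) - \<mu> h))\<^sup>2)"
proof -
  define F where "F a = (cmod ((\<Sum>n | n \<in> {1..N} \<and> [n = a] (mod q). d1 n) - \<mu> (gcd a q)))\<^sup>2" for a
  define r where "r = N mod q"
  \<comment> \<open>The bound a \<le> r gives the class of \<open>a\<close> its extra element; a
    \<le> q - 1 - r means q - a > r, so the class of \<open>q - a\<close> has none. The two ranges
    of residues are therefore disjoint.\<close>
  define s where "s = min r (q - 1 - r)"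
  have r: "r < q" using assms by (simp add: r_def)
  have count: "(\<Sum>n | n \<in> {1..N} \<and> [n = a] (mod q). d1 n)
      = of_nat (N div q + (if a \<le> r then 1 else 0))" if "1 \<le> a" "a \<le> q" for a
    using card_residue_class[OF that, of N] by (simp add: d1_def r_def)
  have pair: "1 / 2 \<le> F a + F (q - a)" if a: "a \<in> {1..s}" for a
  proof -
    have a': "1 \<le> a" "a \<le> r" "a \<le> q" "1 \<le> q - a" "\<not> q - a \<le> r"
      using a r by (auto simp: s_def)
    have g: "gcd (q - a) q = gcd a q" using a' by (intro gcd_diff_self_nat)
    show ?thesis
      using sum_squares_ge_half_diff_square[of "of_nat (N div q + 1)" "of_nat (N div q)" "\<mu> (gcd a q)"] a'
      unfolding F_def g by (subst (1 2) count) auto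
  qed
  have "real s / 2 = (\<Sum>a\<in>{1..s}. 1 / 2)" by simp
  also have "\<dots> \<le> (\<Sum>a\<in>{1..s}. F a + F (q - a))" by (intro sum_mono pair)
  also have "\<dots> = sum F {1..s} + sum F ((\<lambda>a. q - a) ` {1..s})"
    using r by (subst sum.reindex) (auto simp: sum.distrib inj_on_def s_def)
  also have "\<dots> = sum F ({1..s} \<union> (\<lambda>a. q - a) ` {1..s})"
    using r by (intro sum.union_disjoint[symmetric]) (auto simp: s_def)
  also have "\<dots> \<le> sum F {1..q}"
    using r by (intro sum_mono2) (auto simp: s_def F_def)
  also have "\<dots> = (\<Sum>h | h dvd q. sum F {a \<in> {1..q}. gcd a q = h})"
    using assms by (intro sum.group[symmetric]) auto
  also have "\<dots> = (\<Sum>h | h dvd q. \<Sum>a | a \<in> {1..q} \<and> gcd a q = h.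
      (cmod ((\<Sum>n | n \<in> {1..N} \<and> [n = a] (mod q). d1 n) - \<mu> h))\<^sup>2)"
    by (intro sum.cong) (auto simp: F_def)
  finally have ge: "real s / 2 \<le> \<dots>" .
  have N: "real N = real (N div q) * real q + real r"
    unfolding r_def by (metis div_mult_mod_eq of_nat_add of_nat_mult)
  \<comment> \<open>Comparing N / q with the integers N div q and N div q + 1 bounds q times the
    distance by r and by q - r. The loss of 1 in the lemma comes from q - 1 - r in place of q -
    r.\<close>
  have "real q * int_dist (real N / real q) \<le> real q * \<bar>real N / real q - of_int (int (N div q))\<bar>"
    by (intro mult_left_mono int_dist_le) simp
  also have "\<dots> = real r" using assms by (simp add: N field_simps)
  finally have 1: "real q * int_dist (real N / real q) \<le> real r" .
  have "real q * int_dist (real N / real q) \<le> real q * \<bar>real N / real q - of_int (int (N div q) + 1)\<bar>"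
    by (intro mult_left_mono int_dist_le) simp
  also have "real N / real q - of_int (int (N div q) + 1) = - ((real q - real r) / real q)"
    using assms by (simp add: N field_simps)
  also have "real q * \<bar>- ((real q - real r) / real q)\<bar> = real q - real r"
    using assms r by simp
  finally have 2: "real q * int_dist (real N / real q) \<le> real q - real r" .
  have "real q * int_dist (real N / real q) - 1 \<le> real s"
    using 1 2 r by (simp add: s_def min_def of_nat_diff)
  then show ?thesis using ge by simp
qed

text \<open>At least 3K/8 pairs (q, q + t) contribute at least 1/16 each, and each modulus occurs in
  at most two pairs; this gives 3K/256.\<close>

lemma sum_int_dist_quotients_ge:
  fixes N K :: nat
  assumes "0 < K" "K \<le> N" "16 * N \<le> K\<^sup>2"
  shows "3 * real K / 256 \<le> (\<Sum>q\<in>{K div 2 + 1..K}. int_dist (real N / real q))"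
proof -
  define t where "t = K\<^sup>2 div (8 * N)"
  define S where "S = (\<Sum>q\<in>{K div 2 + 1..K}. int_dist (real N / real q))"
  define J where "J = {K div 2 + 1..K - t}"
  have N: "N > 0" using assms by simp
  have "8 * N * t \<le> K\<^sup>2" unfolding t_def by (rule times_div_less_eq_dividend)
  then have "real (8 * N * t) \<le> real (K\<^sup>2)" by (rule of_nat_mono)
  then have t_le: "8 * (real N * real t) \<le> (real K)\<^sup>2" by simp
  have "2 \<le> t" using assms N by (simp add: t_def less_eq_div_iff_mult_less_eq)
  \<comment> \<open>As t \<ge> 2, rounding down costs at most a factor 2, so K^2/16 \<le> N t \<le>
    K^2/8. Below, q (q + t) lies between K^2/4 and K^2, which places the difference of the quotients
    in [1/16, 1/2].\<close>
  have "K\<^sup>2 < 8 * N * (t + 1)"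
    using dividend_less_times_div[of "8 * N" "K\<^sup>2"] N by (simp add: t_def)
  also have "\<dots> \<le> 8 * N * (2 * t)" using \<open>2 \<le> t\<close> by (intro mult_le_mono2) simp
  finally have "real (K\<^sup>2) \<le> real (8 * N * (2 * t))" by (intro of_nat_mono) simp
  then have t_ge: "(real K)\<^sup>2 \<le> 16 * (real N * real t)" by simp
  \<comment> \<open>From K \<le> N follows t \<le> K/8, so removing the top \<open>t\<close> moduli
    from the upper half still leaves at least 3K/8.\<close>
  have "8 * (K * t) \<le> 8 * (N * t)" using assms by simp
  also have "\<dots> \<le> K\<^sup>2" using \<open>8 * N * t \<le> K\<^sup>2\<close> by simp
  finally have "K * (8 * t) \<le> K * K" by (simp add: power2_eq_square)
  then have t8: "8 * t \<le> K" using assms by simp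
  have step: "1 / 16 \<le> int_dist (real N / real q) + int_dist (real N / real (q + t))"
    if q: "q \<in> J" for q
  proof (rule int_dist_add_ge)
    have q': "0 < q" "real K \<le> 2 * real q" "real (q + t) \<le> real K"
      using q t8 by (auto simp: J_def)
    have diff: "real N / real q - real N / real (q + t) = real N * real t / (real q * real (q + t))"
      using q' by (simp add: field_simps)
    have "real q * real (q + t) \<le> real K * real K"
      using q' by (intro mult_mono) auto
    then have "real q * real (q + t) \<le> 16 * (real N * real t)"
      using t_ge by (simp add: power2_eq_square)
    then show "1 / 16 \<le> real N / real q - real N / real (q + t)"
      unfolding diff using q' by (subst pos_le_divide_eq) simp_all
    have "real K * real K \<le> (2 * real q) * (2 * real (q + t))"
      using q' by (intro mult_mono) auto
    then have "2 * (real N * real t) \<le> real q * real (q + t)"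
      using t_le by (simp add: power2_eq_square algebra_simps)
    then have "real N * real t / (real q * real (q + t)) \<le> 1 / 2"
      using q' by (subst pos_divide_le_eq) simp_all
    then show "real N / real q - real N / real (q + t) \<le> 1 - 1 / 16"
      unfolding diff by linarith
  qed
  have "3 * K \<le> 8 * (K - t - K div 2)" using t8 by linarith
  then have "3 * real K \<le> 8 * real (card J)" by (simp add: J_def)
  then have "3 * real K / 128 \<le> (\<Sum>q\<in>J. 1 / 16)" by simp
  also have "\<dots> \<le> (\<Sum>q\<in>J. int_dist (real N / real q) + int_dist (real N / real (q + t)))"
    by (intro sum_mono step)
  also have "\<dots> = (\<Sum>q\<in>J. int_dist (real N / real q))
      + (\<Sum>q\<in>(\<lambda>q. q + t) ` J. int_dist (real N / real q))"
    by (subst sum.reindex) (auto simp: sum.distrib inj_on_def)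
  \<comment> \<open>Both \<open>J\<close> and its shift by \<open>t\<close> lie inside the range of
    \<open>S\<close>, whose terms are nonnegative.\<close>
  also have "\<dots> \<le> S + S"
    unfolding S_def using t8
    by (intro add_mono sum_mono2) (auto simp: J_def int_dist_nonneg)
  finally show ?thesis by (simp add: S_def)
qed

text \<open>Only moduli above K/2 are kept, so that the weight \<open>q\<close> can be replaced by
  K/2. The main term is then 3K^2/1024, and K \<ge> 1024 bounds the total loss K/2 by K^2/2048. What
  remains exceeds K^2/1024 \<ge> Q^2/4096.\<close>

lemma ap_variance_d1_ge:
  fixes N :: nat and Q :: real
  assumes "2048 \<le> Q" "Q \<le> real N" "8 * sqrt (real N) \<le> Q"
  shows "Q\<^sup>2 / 4096 \<le> ap_variance N Q d1"
proof -
  define K where "K = nat \<lfloor>Q\<rfloor>"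
  define G where "G q = (\<Sum>h | h dvd q. \<Sum>a | a \<in> {1..q} \<and> gcd a q = h.
        (cmod ((\<Sum>n | n \<in> {1..N} \<and> [n = a] (mod q). d1 n)
               - 1 / of_nat (totient (q div h)) * (\<Sum>n | n \<in> {1..N} \<and> gcd n q = h. d1 n)))\<^sup>2)" for q
  define I where "I = {K div 2 + 1..K}"
  have K: "real K \<le> Q" "Q < real K + 1" using assms by (auto simp: K_def)
  then have K': "K \<le> N" "1024 \<le> real K" "Q \<le> 2 * real K" using assms by linarith+
  \<comment> \<open>Passing to the integer part costs at most a factor 2, which is why
    \<open>Q\<close> is assumed to be at least 8 sqrt N rather than 4 sqrt N.\<close>
  have "4 * sqrt (real N) \<le> real K" using K' assms by linarith
  then have "(4 * sqrt (real N))\<^sup>2 \<le> (real K)\<^sup>2" by (intro power_mono) auto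
  then have "real (16 * N) \<le> real (K\<^sup>2)" by (simp add: power_mult_distrib)
  then have "16 * N \<le> K\<^sup>2" by (simp only: of_nat_le_iff)
  then have D: "3 * real K / 256 \<le> (\<Sum>q\<in>I. int_dist (real N / real q))"
    unfolding I_def using K' by (intro sum_int_dist_quotients_ge) auto
  have "card I \<le> K" by (simp add: I_def)
  then have card: "real (card I) \<le> real K" by simp
  have "1024 * real K \<le> real K * real K" using K' by (intro mult_right_mono) auto
  moreover have "Q\<^sup>2 \<le> (2 * real K)\<^sup>2" using K' assms by (intro power_mono) auto
  ultimately have "Q\<^sup>2 / 4096 \<le> real K / 4 * (3 * real K / 256) - real K / 2"
    by (simp add: power2_eq_square)
  also have "\<dots> \<le> real K / 4 * (\<Sum>q\<in>I. int_dist (real N / real q)) - real (card I) / 2"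
    using D card by (intro diff_mono mult_left_mono) auto
  also have "\<dots> = (\<Sum>q\<in>I. (real K / 2 * int_dist (real N / real q) - 1) / 2)"
    by (simp add: sum_distrib_left sum_subtractf diff_divide_distrib mult.assoc)
  also have "\<dots> \<le> (\<Sum>q\<in>I. (real q * int_dist (real N / real q) - 1) / 2)"
    by (intro sum_mono divide_right_mono diff_mono mult_right_mono int_dist_nonneg)
       (auto simp: I_def)
  also have "\<dots> \<le> sum G I"
    unfolding G_def by (intro sum_mono residue_class_variance_ge) (auto simp: I_def)
  also have "\<dots> \<le> sum G {1..K}"
    by (intro sum_mono2) (auto simp: I_def G_def intro!: sum_nonneg)
  also have "\<dots> = ap_variance N Q d1"
    by (simp add: ap_variance_def G_def K_def)
  finally show ?thesis .
qed

theorem theorem1p1: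
  shows "\<exists>c>0. \<exists>\<kappa>>0. \<forall>\<^sub>F N :: nat in sequentially. \<forall>Q :: real.
           c * real N powr (2 / 3) \<le> Q \<and> Q \<le> real N \<longrightarrow> ap_variance N Q d1 \<ge> \<kappa> * Q\<^sup>2"
proof -
  \<comment> \<open>For large \<open>N\<close> the bound Q \<ge> N^(2/3) implies both lower bounds
    on \<open>Q\<close> in \<open>ap_variance_d1_ge\<close>, so c = 1 and \<kappa> = 1/4096
    work.\<close>
  have "\<forall>\<^sub>F N :: nat in sequentially. 8 * sqrt (real N) \<le> real N powr (2 / 3)"
    by real_asymp
  moreover have "\<forall>\<^sub>F N :: nat in sequentially. 2048 \<le> real N powr (2 / 3)"
    by real_asymp
  ultimately have "\<forall>\<^sub>F N :: nat in sequentially. \<forall>Q :: real.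
      1 * real N powr (2 / 3) \<le> Q \<and> Q \<le> real N \<longrightarrow> ap_variance N Q d1 \<ge> 1 / 4096 * Q\<^sup>2"
  proof eventually_elim
    case (elim N)
    show ?case
    proof (intro allI impI)
      fix Q :: real
      assume "1 * real N powr (2 / 3) \<le> Q \<and> Q \<le> real N"
      then have "Q\<^sup>2 / 4096 \<le> ap_variance N Q d1"
        using elim by (intro ap_variance_d1_ge) linarith+
      then show "ap_variance N Q d1 \<ge> 1 / 4096 * Q\<^sup>2" by simp
    qed
  qed
  then show ?thesis by (intro exI[of _ 1] exI[of _ "1 / 4096"] conjI) auto
qed

end
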